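(* Let $(\mathbf{X},\mathcal{X})$ and $(\mathbf{Y},\mathcal{Y})$ be standard Borel spaces and let $P_{XY}$ be a probability measure on $\mathbf{X}\times\mathbf{Y}$ with marginals $P_X$ and $P_Y$. Suppose $Q$ is a probability measure on $\mathbf{X}\times\mathbf{Y}$ with second marginal $Q_Y=P_Y$ such that $P_{X|Y}(\cdot,y)\ll Q_{X|Y}(\cdot,y)$ for $P_Y$-a.e. $y\in\mathbf{Y}$. Then, with $H$ and $\bar{\mathbf{Y}}$ as defined in the context, for every $y\in\bar{\mathbf{Y}}$ the conditional measure $P_{X|Y}(\cdot,y)$ is the unique minimizer of $$\min_{\tilde P\in\mathcal{P}(\mathcal{X})}\left\{h\left(\tilde P\,\|\,Q_{X|Y}(\cdot,y)\right)+\langle H(\cdot,y),\tilde P\rangle\right\}.$$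
   Context: $\mathcal{P}(\mathcal{X})$ is the set of probability measures on $(\mathbf{X},\mathcal{X})$. $P_{X|Y}(\cdot,y)$ and $Q_{X|Y}(\cdot,y)$ denote regular conditional distributions of the first coordinate given that the second equals $y$, under $P_{XY}$ and $Q$ respectively. For $y$ such that $P_{X|Y}(\cdot,y)\ll Q_{X|Y}(\cdot,y)$, define the energy $$H(x,y):=-\log\frac{dP_{X|Y}(\cdot,y)}{dQ_{X|Y}(\cdot,y)}(x)\in(-\infty,\infty],$$ with $-\log 0=+\infty$ and $\exp(-\infty)=0$, and the normalizing constant $Z(y):=\int_{\mathbf{X}}\exp(-H(x,y))\,Q_{X|Y}(dx,y)$. Define $\bar{\mathbf{Y}}$ as the set of those $y$ for which $$0<Z(y)<\infty\quad\text{and}\quad\int_{\mathbf{X}}|H(x,y)|\exp(-H(x,y))\,Q_{X|Y}(dx,y)<\infty,$$ with the convention $\infty\cdot\exp(-\infty)=0$. $h(\tilde P\,\|\,R)$ is the relative entropy, equal to $\int\log\frac{d\tilde P}{dR}\,d\tilde P$ if $\tilde P\ll R$ and $+\infty$ otherwise. The pairing is $\langle H(\cdot,y),\tilde P\rangle:=\int_{\mathbf{X}}H(x,y)\,\tilde P(dx)$ if $H(\cdot,y)$ is $\tilde P$-integrable, and $+\infty$ otherwise. *)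

theory Defs
  imports "HOL-Probability.Probability"
begin

text \<open>The \<open>polish_space\<close> type class would force the topology onto the whole type and restrict
  to one fixed \<open>borel\<close> algebra; here the topology is an existentially quantified abstract one on
  the carrier \<open>space M\<close>.\<close>

definition standard_borel :: "'a measure \<Rightarrow> bool" where
  "standard_borel M \<longleftrightarrow>
    (\<exists>T. topspace T = space M \<and> completely_metrizable_space T \<and> separable_space T \<and>
         sets M = sigma_sets (space M) {U. openin T U})"

abbreviation snd_marginal :: "'b measure \<Rightarrow> ('a \<times> 'b) measure \<Rightarrow> 'b measure" where
  "snd_marginal Y P \<equiv> distr P Y snd"

definition regular_cond_dist ::
  "'a measure \<Rightarrow> 'b measure \<Rightarrow> ('a \<times> 'b) measure \<Rightarrow> ('b \<Rightarrow> 'a measure) \<Rightarrow> bool" where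
  "regular_cond_dist X Y P K \<longleftrightarrow>
    K \<in> Y \<rightarrow>\<^sub>M prob_algebra X \<and>
    (\<forall>A\<in>sets X. \<forall>B\<in>sets Y.
       emeasure P (A \<times> B) = (\<integral>\<^sup>+y\<in>B. emeasure (K y) A \<partial>(snd_marginal Y P)))"

text \<open>Logarithm of a nonnegative real and exponential of an extended real, with
  \<open>log 0 = -\<infinity>\<close> and \<open>exp (-\<infinity>) = 0\<close>.\<close>

definition ext_log :: "real \<Rightarrow> ereal" where
  "ext_log t = (if t > 0 then ereal (ln t) else -\<infinity>)"

fun ext_exp :: "ereal \<Rightarrow> ennreal" where
  "ext_exp (ereal r) = ennreal (exp r)"
| "ext_exp PInfty = \<top>"
| "ext_exp MInfty = 0"

text \<open>The Lebesgue integral of an extended-real function: the difference of the integrals of the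
  positive and the negative part (\<open>e2ennreal\<close> maps negative numbers to 0). It is used below only
  where at most one of the two is infinite. The Bochner integral, hence also \<open>KL_divergence\<close>, is
  unsuitable because it returns 0 where this one is infinite.\<close>

definition ext_integral :: "'a measure \<Rightarrow> ('a \<Rightarrow> ereal) \<Rightarrow> ereal" where
  "ext_integral M f =
    enn2ereal (\<integral>\<^sup>+x. e2ennreal (f x) \<partial>M) - enn2ereal (\<integral>\<^sup>+x. e2ennreal (- f x) \<partial>M)"

text \<open>In \<open>RN_deriv\<close> and \<open>absolutely_continuous\<close> the dominating measure is the first argument.
  \<open>enn2real\<close> selects a version of the density with values in \<open>[0, \<infinity>)\<close>: for finite measures
  \<open>RN_deriv\<close> is infinite at most on a null set of the dominating measure.\<close>

definition rel_entropy :: "'a measure \<Rightarrow> 'a measure \<Rightarrow> ereal" where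
  "rel_entropy P R =
    (if absolutely_continuous R P
     then ext_integral P (\<lambda>x. ext_log (enn2real (RN_deriv R P x))) else \<infinity>)"

definition energy :: "('b \<Rightarrow> 'a measure) \<Rightarrow> ('b \<Rightarrow> 'a measure) \<Rightarrow> 'a \<Rightarrow> 'b \<Rightarrow> ereal" where
  "energy PXgY QXgY x y = - ext_log (enn2real (RN_deriv (QXgY y) (PXgY y) x))"

definition normalizer :: "('b \<Rightarrow> 'a measure) \<Rightarrow> ('b \<Rightarrow> 'a measure) \<Rightarrow> 'b \<Rightarrow> ennreal" where
  "normalizer PXgY QXgY y = (\<integral>\<^sup>+x. ext_exp (- energy PXgY QXgY x y) \<partial>(QXgY y))"

text \<open>The energy is defined only for those \<open>y\<close> at which absolute continuity holds, so this is
  part of the membership condition. The convention \<open>\<infinity> * exp (-\<infinity>) = 0\<close> is \<open>\<top> * 0 = 0\<close> in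
  \<open>ennreal\<close>.\<close>

definition Ybar :: "'b measure \<Rightarrow> ('b \<Rightarrow> 'a measure) \<Rightarrow> ('b \<Rightarrow> 'a measure) \<Rightarrow> 'b set" where
  "Ybar Y PXgY QXgY =
    {y \<in> space Y. absolutely_continuous (QXgY y) (PXgY y) \<and>
       0 < normalizer PXgY QXgY y \<and> normalizer PXgY QXgY y < \<infinity> \<and>
       (\<integral>\<^sup>+x. e2ennreal \<bar>energy PXgY QXgY x y\<bar> * ext_exp (- energy PXgY QXgY x y) \<partial>(QXgY y)) < \<infinity>}"

definition pairing :: "('a \<Rightarrow> ereal) \<Rightarrow> 'a measure \<Rightarrow> ereal" where
  "pairing H P =
    (if H \<in> borel_measurable P \<and> (\<integral>\<^sup>+x. e2ennreal \<bar>H x\<bar> \<partial>P) < \<infinity>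
     then ext_integral P H else \<infinity>)"

end

theory Submission
  imports Defs
begin

text \<open>
  Fix \<open>y\<close> and write \<open>M = QXgY y\<close>, \<open>N = PXgY y\<close>, and \<open>f\<close> for the density of \<open>N\<close> with respect to
  \<open>M\<close>, so that the energy is \<open>- log f\<close>. For a probability measure \<open>P' = g M\<close> at which the objective
  is finite, the two terms combine into \<open>\<integral> (log g - log f) dP'\<close>, which is the relative
  entropy of \<open>P'\<close> with respect to \<open>N\<close>. It is therefore nonnegative, and zero only for \<open>P' = N\<close>, by
  the Gibbs inequality \<open>log u \<le> u - 1\<close> applied to \<open>u = f / g\<close>
  (\<open>gibbs_inequality\<close>, \<open>gibbs_equality\<close>).

  What remains is to see that infinite values do no harm. The negative part of \<open>log g\<close> always has
  finite \<open>P'\<close>-integral, so the relative entropy is either a genuine integral or \<open>\<infinity>\<close>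
  (\<open>rel_entropy_cases\<close>), and the pairing never takes the value \<open>-\<infinity>\<close> (\<open>pairing_energy_cases\<close>).
  Hence the sum is \<open>\<infinity>\<close> as soon as one of its terms is. The integrability condition that defines
  \<open>Ybar\<close> makes both terms finite at \<open>N\<close>, where they cancel: the minimum is 0.
\<close>

section \<open>Extended integrals and real densities\<close>

lemma ext_integral_eq_integral:
  assumes "integrable M u" "AE x in M. F x = ereal (u x)"
  shows "ext_integral M F = ereal (\<integral>x. u x \<partial>M)"
proof -
  have pos: "(\<integral>\<^sup>+x. e2ennreal (F x) \<partial>M) = (\<integral>\<^sup>+x. ennreal (u x) \<partial>M)"
    using assms(2) by (intro nn_integral_cong_AE) auto
  have neg: "(\<integral>\<^sup>+x. e2ennreal (- F x) \<partial>M) = (\<integral>\<^sup>+x. ennreal (- u x) \<partial>M)"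
    using assms(2) by (intro nn_integral_cong_AE) auto
  obtain r q where rq: "0 \<le> r" "0 \<le> q"
    "(\<integral>\<^sup>+x. ennreal (u x) \<partial>M) = ennreal r" "(\<integral>\<^sup>+x. ennreal (- u x) \<partial>M) = ennreal q"
    "(\<integral>x. u x \<partial>M) = r - q"
    using integrableE[OF assms(1)] by metis
  show ?thesis
    unfolding ext_integral_def pos neg rq using rq(1,2) by (simp add: enn2ereal_ennreal)
qed

lemma prob_density_enn2real_RN_deriv:
  assumes "prob_space M" "prob_space N" "sets N = sets M" "absolutely_continuous M N"
  shows "density M (\<lambda>x. ennreal (enn2real (RN_deriv M N x))) = N"
proof -
  interpret M: prob_space M by fact
  interpret N: prob_space N by fact
  have "AE x in M. RN_deriv M N x \<noteq> \<infinity>"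
    using assms by (intro M.RN_deriv_finite N.sigma_finite_measure_axioms)
  then have "density M (\<lambda>x. ennreal (enn2real (RN_deriv M N x))) = density M (RN_deriv M N)"
    by (intro density_cong) (auto simp: less_top)
  with M.density_RN_deriv[OF assms(4,3)] show ?thesis by simp
qed

lemma AE_density_pos:
  fixes g :: "'a \<Rightarrow> real"
  assumes [measurable]: "g \<in> borel_measurable M"
  shows "AE x in density M (\<lambda>x. ennreal (g x)). 0 < g x"
  by (subst AE_density) auto

section \<open>The two terms of the objective\<close>

text \<open>The negative part of \<open>log g\<close> is integrable against \<open>g M\<close> because \<open>- g log g \<le> 1 - g \<le> 1\<close>
  and \<open>M\<close> has total mass 1. So if \<open>log g\<close> fails to be integrable, its integral is \<open>\<infinity>\<close>.\<close>

lemma rel_entropy_cases: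
  fixes M N :: "'a measure"
  defines "g \<equiv> \<lambda>x. enn2real (RN_deriv M N x)"
  assumes "prob_space M" "prob_space N" "sets N = sets M" "absolutely_continuous M N"
  shows "integrable N (\<lambda>x. ln (g x)) \<and> rel_entropy N M = ereal (\<integral>x. ln (g x) \<partial>N)
    \<or> rel_entropy N M = \<infinity>"
proof -
  interpret M: prob_space M by fact
  have [measurable]: "g \<in> borel_measurable M" unfolding g_def by measurable
  have [measurable]: "g \<in> borel_measurable N" using assms(4) by simp
  have N: "density M (\<lambda>x. ennreal (g x)) = N"
    unfolding g_def by (intro prob_density_enn2real_RN_deriv assms)
  have ext: "AE x in N. ext_log (g x) = ereal (ln (g x))"
    using AE_density_pos[of g M] unfolding N by (auto simp: ext_log_def)
  have re: "rel_entropy N M = ext_integral N (\<lambda>x. ext_log (g x))"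
    using assms(5) unfolding rel_entropy_def g_def by simp
  show ?thesis
  proof (cases "integrable N (\<lambda>x. ln (g x))")
    case True
    then show ?thesis using ext_integral_eq_integral[OF True ext] re by simp
  next
    case False
    have bound: "ennreal (g x) * ennreal (- ln (g x)) \<le> 1" for x
    proof (cases "0 < g x")
      case True
      have "g x * - ln (g x) = g x * ln (1 / g x)" using True by (simp add: ln_div)
      also have "\<dots> \<le> g x * (1 / g x - 1)"
        using True by (intro mult_left_mono ln_le_minus_one) auto
      also have "\<dots> \<le> 1" using True by (simp add: field_simps)
      finally have "g x * - ln (g x) \<le> 1" .
      then show ?thesis using True
        by (metis ennreal_1 ennreal_leI ennreal_mult' less_imp_le)
    next
      case False
      then show ?thesis by (simp add: ennreal_neg)
    qed
    have "(\<integral>\<^sup>+x. ennreal (- ln (g x)) \<partial>N) = (\<integral>\<^sup>+x. ennreal (g x) * ennreal (- ln (g x)) \<partial>M)"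
      unfolding N[symmetric] by (subst nn_integral_density) auto
    also have "\<dots> \<le> (\<integral>\<^sup>+x. 1 \<partial>M)" by (intro nn_integral_mono bound)
    finally have neg: "(\<integral>\<^sup>+x. ennreal (- ln (g x)) \<partial>N) < \<infinity>"
      by (simp add: M.emeasure_space_1 less_top order_le_less_trans)
    then have pos: "(\<integral>\<^sup>+x. ennreal (ln (g x)) \<partial>N) = \<infinity>"
      using False unfolding real_integrable_def by auto
    have "(\<integral>\<^sup>+x. e2ennreal (ext_log (g x)) \<partial>N) = (\<integral>\<^sup>+x. ennreal (ln (g x)) \<partial>N)"
         "(\<integral>\<^sup>+x. e2ennreal (- ext_log (g x)) \<partial>N) = (\<integral>\<^sup>+x. ennreal (- ln (g x)) \<partial>N)"
      using ext by (auto intro!: nn_integral_cong_AE)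
    moreover obtain q where "0 \<le> q" "(\<integral>\<^sup>+x. ennreal (- ln (g x)) \<partial>N) = ennreal q"
      using neg by (cases "\<integral>\<^sup>+x. ennreal (- ln (g x)) \<partial>N") auto
    ultimately have "ext_integral N (\<lambda>x. ext_log (g x)) = \<infinity>"
      unfolding ext_integral_def using pos by (simp add: enn2ereal_ennreal top_ereal_def)
    then show ?thesis using re by simp
  qed
qed

text \<open>The energy is infinite exactly where \<open>f \<le> 0\<close>, so a finite absolute integral forces
  \<open>f > 0\<close> almost surely and makes the pairing an ordinary integral. The second alternative records
  the infinite absolute integral, so that finiteness of that integral alone selects the first.\<close>

lemma pairing_energy_cases:
  fixes f :: "'a \<Rightarrow> real"
  assumes [measurable]: "f \<in> borel_measurable N"
  shows "(AE x in N. 0 < f x) \<and> integrable N (\<lambda>x. ln (f x))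
      \<and> pairing (\<lambda>x. - ext_log (f x)) N = ereal (- (\<integral>x. ln (f x) \<partial>N))
    \<or> pairing (\<lambda>x. - ext_log (f x)) N = \<infinity> \<and> (\<integral>\<^sup>+x. e2ennreal \<bar>- ext_log (f x)\<bar> \<partial>N) = \<infinity>"
proof (cases "(\<integral>\<^sup>+x. e2ennreal \<bar>- ext_log (f x)\<bar> \<partial>N) < \<infinity>")
  case True
  have meas: "(\<lambda>x. - ext_log (f x)) \<in> borel_measurable N" unfolding ext_log_def by measurable
  then have "(\<lambda>x. e2ennreal \<bar>- ext_log (f x)\<bar>) \<in> borel_measurable N" by measurable
  then have "AE x in N. e2ennreal \<bar>- ext_log (f x)\<bar> \<noteq> \<infinity>"
    using True by (intro nn_integral_PInf_AE) auto
  then have pos: "AE x in N. 0 < f x"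
    by eventually_elim (auto simp: ext_log_def split: if_splits)
  then have ext: "AE x in N. ext_log (f x) = ereal (ln (f x))"
    by eventually_elim (simp add: ext_log_def)
  then have "(\<integral>\<^sup>+x. e2ennreal \<bar>- ext_log (f x)\<bar> \<partial>N) = (\<integral>\<^sup>+x. ennreal (norm (ln (f x))) \<partial>N)"
    by (intro nn_integral_cong_AE) auto
  then have int: "integrable N (\<lambda>x. ln (f x))"
    using True by (intro integrableI_bounded) auto
  have "ext_integral N (\<lambda>x. - ext_log (f x)) = ereal (\<integral>x. - ln (f x) \<partial>N)"
    using int ext by (intro ext_integral_eq_integral) auto
  then show ?thesis using True meas pos int by (simp add: pairing_def)
next
  case False
  then show ?thesis by (auto simp: pairing_def not_less top_unique)
qed

section \<open>The Gibbs inequality\<close>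

text \<open>Under \<open>g M\<close> the function \<open>f / g\<close> integrates to the mass that \<open>f M\<close> gives to \<open>{g > 0}\<close>, hence to
  at most 1; it is smaller than 1 when \<open>f M\<close> charges the zero set of \<open>g\<close>.\<close>

lemma density_ratio_integral_le_1:
  fixes f g :: "'a \<Rightarrow> real"
  assumes [measurable]: "f \<in> borel_measurable M" "g \<in> borel_measurable M"
    and nn: "\<And>x. 0 \<le> f x" "\<And>x. 0 \<le> g x"
    and pf: "prob_space (density M (\<lambda>x. ennreal (f x)))"
  shows "integrable (density M (\<lambda>x. ennreal (g x))) (\<lambda>x. f x / g x)"
    and "(\<integral>x. f x / g x \<partial>density M (\<lambda>x. ennreal (g x))) \<le> 1"
proof -
  let ?N = "density M (\<lambda>x. ennreal (g x))"
  have "(\<integral>\<^sup>+x. ennreal (f x / g x) \<partial>?N) = (\<integral>\<^sup>+x. ennreal (g x) * ennreal (f x / g x) \<partial>M)"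
    by (subst nn_integral_density) auto
  also have "\<dots> \<le> (\<integral>\<^sup>+x. ennreal (f x) \<partial>M)"
    using nn by (intro nn_integral_mono) (auto simp: ennreal_mult'[symmetric])
  also have "\<dots> = 1"
    using prob_space.emeasure_space_1[OF pf] by (simp add: emeasure_density cong: nn_integral_cong)
  finally have le: "(\<integral>\<^sup>+x. ennreal (f x / g x) \<partial>?N) \<le> 1" .
  show int: "integrable ?N (\<lambda>x. f x / g x)"
    using nn le by (intro integrableI_nonneg) (auto simp: less_top order_le_less_trans)
  have "ennreal (\<integral>x. f x / g x \<partial>?N) \<le> 1"
    using le nn nn_integral_eq_integral[OF int] by simp
  then show "(\<integral>x. f x / g x \<partial>?N) \<le> 1"
    by simp
qed

lemma ln_diff_ge_one_minus_ratio:
  fixes a b :: real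
  assumes "0 < a" "0 < b"
  shows "0 \<le> ln b - ln a - 1 + a / b"
  using assms ln_le_minus_one[of "a / b"] by (simp add: ln_div)

lemma gibbs_inequality:
  fixes f g :: "'a \<Rightarrow> real" and M :: "'a measure"
  defines "N \<equiv> density M (\<lambda>x. ennreal (g x))"
  assumes [measurable]: "f \<in> borel_measurable M" "g \<in> borel_measurable M"
    and nn: "\<And>x. 0 \<le> f x" "\<And>x. 0 \<le> g x"
    and pf: "prob_space (density M (\<lambda>x. ennreal (f x)))" and pg: "prob_space N"
    and pos: "AE x in N. 0 < f x"
    and int: "integrable N (\<lambda>x. ln (f x))" "integrable N (\<lambda>x. ln (g x))"
  shows "(\<integral>x. ln (f x) \<partial>N) \<le> (\<integral>x. ln (g x) \<partial>N)"
proof -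
  interpret N: prob_space N by fact
  note ratio = density_ratio_integral_le_1[OF assms(2,3) nn pf, folded N_def]
  have "AE x in N. 0 \<le> ln (g x) - ln (f x) - 1 + f x / g x"
    using pos AE_density_pos[of g M, folded N_def, OF assms(3)]
    by eventually_elim (rule ln_diff_ge_one_minus_ratio)
  then have "0 \<le> (\<integral>x. ln (g x) - ln (f x) - 1 + f x / g x \<partial>N)"
    by (rule integral_nonneg_AE)
  also have "\<dots> = (\<integral>x. ln (g x) \<partial>N) - (\<integral>x. ln (f x) \<partial>N) - 1 + (\<integral>x. f x / g x \<partial>N)"
    using int ratio(1) by (simp add: N.prob_space)
  finally show ?thesis using ratio(2) by simp
qed

text \<open>Equality forces \<open>ln u = u - 1\<close> for \<open>u = f / g\<close>, so \<open>f = g\<close> wherever \<open>g > 0\<close>. The zero set of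
  \<open>g\<close>, about which the integrals under \<open>g M\<close> say nothing, is handled by comparing total masses:
  \<open>g \<le> f\<close> almost everywhere and both densities have integral 1.\<close>

lemma gibbs_equality:
  fixes f g :: "'a \<Rightarrow> real" and M :: "'a measure"
  defines "N \<equiv> density M (\<lambda>x. ennreal (g x))"
  assumes [measurable]: "f \<in> borel_measurable M" "g \<in> borel_measurable M"
    and nn: "\<And>x. 0 \<le> f x" "\<And>x. 0 \<le> g x"
    and pf: "prob_space (density M (\<lambda>x. ennreal (f x)))" and pg: "prob_space N"
    and pos: "AE x in N. 0 < f x"
    and int: "integrable N (\<lambda>x. ln (f x))" "integrable N (\<lambda>x. ln (g x))"
    and eq: "(\<integral>x. ln (g x) \<partial>N) = (\<integral>x. ln (f x) \<partial>N)"
  shows "N = density M (\<lambda>x. ennreal (f x))"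
proof -
  interpret N: prob_space N by fact
  note ratio = density_ratio_integral_le_1[OF assms(2,3) nn pf, folded N_def]
  note posg = AE_density_pos[of g M, folded N_def, OF assms(3)]
  let ?D = "\<lambda>x. ln (g x) - ln (f x) - 1 + f x / g x"
  have D: "AE x in N. 0 \<le> ?D x"
    using pos posg by eventually_elim (rule ln_diff_ge_one_minus_ratio)
  have intD: "integrable N ?D" using int ratio(1) by simp
  have "(\<integral>x. ?D x \<partial>N) = (\<integral>x. f x / g x \<partial>N) - 1"
    using int ratio(1) eq by (simp add: N.prob_space)
  then have "(\<integral>x. ?D x \<partial>N) = 0"
    using ratio(2) integral_nonneg_AE[OF D] by simp
  then have "AE x in N. ?D x = 0"
    using integral_nonneg_eq_0_iff_AE[OF intD D] by simp
  then have "AE x in N. f x = g x"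
    using pos posg
  proof eventually_elim
    case (elim x)
    then have "ln (f x / g x) = f x / g x - 1" by (simp add: ln_div)
    then have "f x / g x = 1" using elim by (intro ln_eq_minus_one) auto
    then show ?case using elim by simp
  qed
  then have fg: "AE x in M. 0 < g x \<longrightarrow> f x = g x"
    unfolding N_def by (subst (asm) AE_density) auto
  have le: "AE x in M. ennreal (g x) \<le> ennreal (f x)"
    using fg
  proof eventually_elim
    case (elim x)
    then show ?case using nn(1)[of x] nn(2)[of x] by (cases "0 < g x") (auto simp: ennreal_leI)
  qed
  have I: "(\<integral>\<^sup>+x. ennreal (f x) \<partial>M) = 1" "(\<integral>\<^sup>+x. ennreal (g x) \<partial>M) = 1"
    using prob_space.emeasure_space_1[OF pf] N.emeasure_space_1
    by (simp_all add: N_def emeasure_density cong: nn_integral_cong)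
  have "(\<integral>\<^sup>+x. ennreal (f x) - ennreal (g x) \<partial>M) = 0"
    using le I by (subst nn_integral_diff) auto
  then have "AE x in M. ennreal (f x) - ennreal (g x) = 0"
    by (subst (asm) nn_integral_0_iff_AE) auto
  with le have "AE x in M. ennreal (g x) = ennreal (f x)"
    by eventually_elim (auto intro: antisym ennreal_minus_eq_0)
  then show ?thesis unfolding N_def by (intro density_cong) auto
qed

section \<open>The variational principle\<close>

text \<open>The objective at a fixed \<open>y\<close>: \<open>M\<close> is the reference measure and \<open>N\<close> the measure whose
  log-density defines the energy.\<close>

definition free_energy :: "'a measure \<Rightarrow> 'a measure \<Rightarrow> 'a measure \<Rightarrow> ereal" where
  "free_energy M N P' =
    rel_entropy P' M + pairing (\<lambda>x. - ext_log (enn2real (RN_deriv M N x))) P'"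

lemma free_energy_nonneg_strict:
  assumes M: "prob_space M" and N: "prob_space N" "sets N = sets M" "absolutely_continuous M N"
    and P': "prob_space P'" "sets P' = sets M"
  shows "0 \<le> free_energy M N P'" and "free_energy M N P' = 0 \<Longrightarrow> P' = N"
proof -
  define f g where "f = (\<lambda>x. enn2real (RN_deriv M N x))" and "g = (\<lambda>x. enn2real (RN_deriv M P' x))"
  have [measurable]: "f \<in> borel_measurable M" "g \<in> borel_measurable M"
    unfolding f_def g_def by measurable
  have fP: "f \<in> borel_measurable P'" using P'(2) by simp
  have nn: "\<And>x. 0 \<le> f x" "\<And>x. 0 \<le> g x" by (auto simp: f_def g_def)
  have Nf: "density M (\<lambda>x. ennreal (f x)) = N"
    unfolding f_def by (intro prob_density_enn2real_RN_deriv assms)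
  let ?pair = "pairing (\<lambda>x. - ext_log (f x)) P'"
  have fe: "free_energy M N P' = rel_entropy P' M + ?pair"
    by (simp add: free_energy_def f_def)
  have "0 \<le> free_energy M N P' \<and> (free_energy M N P' = 0 \<longrightarrow> P' = N)"
  proof (cases "absolutely_continuous M P' \<and> rel_entropy P' M \<noteq> \<infinity> \<and> ?pair \<noteq> \<infinity>")
    case True
    have pos: "AE x in P'. 0 < f x" and intf: "integrable P' (\<lambda>x. ln (f x))"
      and pair: "?pair = ereal (- (\<integral>x. ln (f x) \<partial>P'))"
      using pairing_energy_cases[OF fP] True by auto
    have intg: "integrable P' (\<lambda>x. ln (g x))"
      and re: "rel_entropy P' M = ereal (\<integral>x. ln (g x) \<partial>P')"
      using rel_entropy_cases[OF M P'] True unfolding g_def by auto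
    have Pg: "density M (\<lambda>x. ennreal (g x)) = P'"
      unfolding g_def using True by (intro prob_density_enn2real_RN_deriv assms) auto
    note gibbs_args = \<open>f \<in> borel_measurable M\<close> \<open>g \<in> borel_measurable M\<close> nn
    have le: "(\<integral>x. ln (f x) \<partial>P') \<le> (\<integral>x. ln (g x) \<partial>P')"
      using gibbs_inequality[OF gibbs_args, unfolded Nf Pg, OF N(1) P'(1) pos intf intg] .
    have "P' = N" if "(\<integral>x. ln (g x) \<partial>P') = (\<integral>x. ln (f x) \<partial>P')"
      using gibbs_equality[OF gibbs_args, unfolded Nf Pg, OF N(1) P'(1) pos intf intg that] .
    with le show ?thesis by (auto simp: fe re pair)
  next
    case False
    then have "free_energy M N P' = \<infinity>" unfolding fe by (auto simp: rel_entropy_def)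
    then show ?thesis by simp
  qed
  then show "0 \<le> free_energy M N P'" "free_energy M N P' = 0 \<Longrightarrow> P' = N" by auto
qed

text \<open>At \<open>N\<close> itself both terms are the integral of \<open>log f\<close>, with opposite signs. The integrability
  hypothesis excludes the value \<open>\<infinity>\<close>; it is stated under \<open>M\<close> with the Boltzmann weight
  \<open>exp (log f) = f\<close>, which is the density of \<open>N\<close>.\<close>

lemma free_energy_self:
  fixes M N :: "'a measure"
  defines "H \<equiv> \<lambda>x. - ext_log (enn2real (RN_deriv M N x))"
  assumes M: "prob_space M" and N: "prob_space N" "sets N = sets M" "absolutely_continuous M N"
    and fin: "(\<integral>\<^sup>+x. e2ennreal \<bar>H x\<bar> * ext_exp (- H x) \<partial>M) < \<infinity>"
  shows "free_energy M N N = 0"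
proof -
  define f where "f = (\<lambda>x. enn2real (RN_deriv M N x))"
  have [measurable]: "f \<in> borel_measurable M" unfolding f_def by measurable
  have fN: "f \<in> borel_measurable N" using N(2) by simp
  have Nf: "density M (\<lambda>x. ennreal (f x)) = N"
    unfolding f_def by (intro prob_density_enn2real_RN_deriv assms)
  have H: "H = (\<lambda>x. - ext_log (f x))" by (simp add: H_def f_def)
  have [measurable]: "H \<in> borel_measurable M" unfolding H ext_log_def by measurable
  have weight: "ext_exp (- H x) = ennreal (f x)" for x
    unfolding H ext_log_def using ext_exp.simps(3)[unfolded MInfty_eq_minfinity]
    by (auto simp: ennreal_neg)
  have "(\<integral>\<^sup>+x. e2ennreal \<bar>H x\<bar> \<partial>N) = (\<integral>\<^sup>+x. ennreal (f x) * e2ennreal \<bar>H x\<bar> \<partial>M)"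
    unfolding Nf[symmetric] by (subst nn_integral_density) auto
  also have "\<dots> < \<infinity>" using fin by (simp add: weight mult.commute)
  finally have finN: "(\<integral>\<^sup>+x. e2ennreal \<bar>H x\<bar> \<partial>N) < \<infinity>" .
  have int: "integrable N (\<lambda>x. ln (f x))" and pos: "AE x in N. 0 < f x"
    and pair: "pairing H N = ereal (- (\<integral>x. ln (f x) \<partial>N))"
    using pairing_energy_cases[OF fN] finN unfolding H by auto
  have "AE x in N. ext_log (f x) = ereal (ln (f x))"
    using pos by eventually_elim (simp add: ext_log_def)
  then have "rel_entropy N M = ereal (\<integral>x. ln (f x) \<partial>N)"
    using ext_integral_eq_integral[OF int] N(3) by (simp add: rel_entropy_def f_def)
  then show ?thesis using pair by (simp add: free_energy_def H_def)
qed

theorem theorem6p4: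
  fixes X :: "'a measure" and Y :: "'b measure"
    and P Q :: "('a \<times> 'b) measure"
    and PXgY QXgY :: "'b \<Rightarrow> 'a measure"
  assumes "standard_borel X" and "standard_borel Y"
    and "P \<in> space (prob_algebra (X \<Otimes>\<^sub>M Y))"
    and "Q \<in> space (prob_algebra (X \<Otimes>\<^sub>M Y))"
    and "snd_marginal Y Q = snd_marginal Y P"
    and "regular_cond_dist X Y P PXgY"
    and "regular_cond_dist X Y Q QXgY"
    and "AE y in snd_marginal Y P. absolutely_continuous (QXgY y) (PXgY y)"
  shows "\<forall>y\<in>Ybar Y PXgY QXgY. \<forall>R.
    is_arg_min (\<lambda>P'. rel_entropy P' (QXgY y) + pairing (\<lambda>x. energy PXgY QXgY x y) P')
      (\<lambda>P'. P' \<in> space (prob_algebra X)) R \<longleftrightarrow> R = PXgY y"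
proof (intro ballI allI)
  fix y R
  assume y: "y \<in> Ybar Y PXgY QXgY"
  let ?M = "QXgY y" and ?N = "PXgY y"
  have objective: "rel_entropy P' ?M + pairing (\<lambda>x. energy PXgY QXgY x y) P'
      = free_energy ?M ?N P'" for P'
    by (simp add: free_energy_def energy_def)
  have "y \<in> space Y" and ac: "absolutely_continuous ?M ?N"
    and fin: "(\<integral>\<^sup>+x. e2ennreal \<bar>energy PXgY QXgY x y\<bar> * ext_exp (- energy PXgY QXgY x y) \<partial>?M) < \<infinity>"
    using y by (auto simp: Ybar_def)
  then have memM: "?M \<in> space (prob_algebra X)" and memN: "?N \<in> space (prob_algebra X)"
    using assms(6,7) unfolding regular_cond_dist_def by (auto dest: measurable_space)
  then have M: "prob_space ?M" "sets ?M = sets X" and N: "prob_space ?N" "sets ?N = sets ?M"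
    by (auto simp: space_prob_algebra)
  have zero: "free_energy ?M ?N ?N = 0"
    using fin unfolding energy_def by (intro free_energy_self M N ac)
  have nonneg: "0 \<le> free_energy ?M ?N P'" and uniq: "free_energy ?M ?N P' = 0 \<Longrightarrow> P' = ?N"
    if "P' \<in> space (prob_algebra X)" for P'
    using that M free_energy_nonneg_strict[OF M(1) N ac, of P'] by (auto simp: space_prob_algebra)
  show "is_arg_min (\<lambda>P'. rel_entropy P' ?M + pairing (\<lambda>x. energy PXgY QXgY x y) P')
      (\<lambda>P'. P' \<in> space (prob_algebra X)) R \<longleftrightarrow> R = ?N"
    unfolding objective is_arg_min_def
    using memN zero nonneg uniq by (metis antisym not_less)
qed

end
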